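(* Let $(R,B,L)$ be a Hadamard system in $\mathbb{R}^d$, with associated measures $\mu_B,\mu_L$ and discrete sets $\Gamma(B),\Gamma(L)$. Then $\Gamma(B)$ is orthogonal in $L^2(\mu_L)$, and $\Gamma(L)$ is orthogonal in $L^2(\mu_B)$.
   Context: Hadamard system $(R,B,L)$ in $\mathbb{R}^d$: $R$ is a $d\times d$ matrix with integer entries which is expansive (all eigenvalues $\lambda$ satisfy $|\lambda|>1$); $B,L\subset\mathbb{R}^d$ are finite sets with $0\in B$, $0\in L$, $\#B=\#L=N$; $R^k b\cdot l\in\mathbb{Z}$ for all $b\in B$, $l\in L$ and all integers $k\ge 0$; and the $N\times N$ matrix $\frac{1}{\sqrt N}\left(e^{2\pi i R^{-1}b\cdot l}\right)_{b\in B,\,l\in L}$ is unitary. Measures: for $b\in B$ let $\tau_b(x)=R^{-1}(x+b)$, and for $l\in L$ let $\sigma_l(x)=(R^T)^{-1}(x+l)$, $x\in\mathbb{R}^d$. $\mu_B$ is the unique Borel probability measure on $\mathbb{R}^d$ with $\mu_B=\frac1N\sum_{b\in B}\mu_B\circ\tau_b^{-1}$, and $\mu_L$ is the unique Borel probability measure with $\mu_L=\frac1N\sum_{l\in L}\mu_L\circ\sigma_l^{-1}$. Discrete sets: $\Gamma(B)=\{\sum_{k=0}^n R^k b_k : b_k\in B,\ n\ge 0\}$ and $\Gamma(L)=\{\sum_{k=0}^n (R^T)^k l_k : l_k\in L,\ n\ge 0\}$. For $t\in\mathbb{R}^d$, $e_t(x)=e^{2\pi i t\cdot x}$. A set $\Gamma\subset\mathbb{R}^d$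 is called orthogonal in $L^2(\mu)$ if $\langle e_{\gamma_1},e_{\gamma_2}\rangle_{L^2(\mu)}=0$ for all $\gamma_1\ne\gamma_2$ in $\Gamma$. *)

theory Defs
  imports "HOL-Probability.Probability"
begin

definition eigenvalue_of :: "complex^'d^'d \<Rightarrow> complex \<Rightarrow> bool" where
  "eigenvalue_of A z \<longleftrightarrow> (\<exists>v. v \<noteq> 0 \<and> A *v v = z *s v)"

text \<open>All complex eigenvalues count, so the real matrix is complexified first.\<close>

definition expansive :: "real^'d^'d \<Rightarrow> bool" where
  "expansive R \<longleftrightarrow>
     (\<forall>z. eigenvalue_of (\<chi> i j. complex_of_real (R $ i $ j)) z \<longrightarrow> norm z > 1)"

text \<open>
  Unitarity of a complex matrix \<open>U\<close> whose rows are indexed by \<open>I\<close> and columns by \<open>J\<close>: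
  \<open>U\<^sup>* U = 1\<close> and \<open>U U\<^sup>* = 1\<close>.
\<close>

definition unitary_on :: "'a set \<Rightarrow> 'b set \<Rightarrow> ('a \<Rightarrow> 'b \<Rightarrow> complex) \<Rightarrow> bool" where
  "unitary_on I J U \<longleftrightarrow>
     (\<forall>j\<in>J. \<forall>j'\<in>J. (\<Sum>i\<in>I. cnj (U i j) * U i j') = (if j = j' then 1 else 0)) \<and>
     (\<forall>i\<in>I. \<forall>i'\<in>I. (\<Sum>j\<in>J. U i j * cnj (U i' j)) = (if i = i' then 1 else 0))"

definition expo :: "real^'d \<Rightarrow> real^'d \<Rightarrow> complex" where
  "expo t x = exp (2 * complex_of_real pi * \<i> * complex_of_real (t \<bullet> x))"

text \<open>
  The matrix power acting on a vector, \<open>R\<^sup>k b\<close>, is written as the \<open>k\<close>-fold iterate of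
  \<open>(*v) R\<close>: the power \<open>R ^ k\<close> of the vector type would be entrywise.
\<close>

definition hadamard_system :: "real^'d^'d \<Rightarrow> (real^'d) set \<Rightarrow> (real^'d) set \<Rightarrow> bool" where
  "hadamard_system R B L \<longleftrightarrow>
     (\<forall>i j. R $ i $ j \<in> \<int>) \<and> expansive R \<and>
     finite B \<and> finite L \<and> 0 \<in> B \<and> 0 \<in> L \<and> card B = card L \<and>
     (\<forall>b\<in>B. \<forall>l\<in>L. \<forall>k::nat. (((*v) R ^^ k) b) \<bullet> l \<in> \<int>) \<and>
     unitary_on B L (\<lambda>b l. complex_of_real (1 / sqrt (real (card B))) *
       exp (2 * complex_of_real pi * \<i> * complex_of_real ((matrix_inv R *v b) \<bullet> l)))"

definition ifs_map :: "real^'d^'d \<Rightarrow> real^'d \<Rightarrow> real^'d \<Rightarrow> real^'d" where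
  "ifs_map R b x = matrix_inv R *v (x + b)"

text \<open>
  \<open>M\<close> is a Borel probability measure with \<open>M = 1/N \<Sum>\<^sub>b M \<circ> \<tau>\<^sub>b\<^sup>-\<^sup>1\<close>. For expansive \<open>R\<close> and
  finite nonempty \<open>B\<close> exactly one such measure exists. The measure
  \<open>\<mu>\<^sub>B\<close> is obtained from \<open>R\<close> and \<open>B\<close>, the measure \<open>\<mu>\<^sub>L\<close> from \<open>transpose R\<close> and \<open>L\<close>;
  likewise for the sets \<open>\<Gamma>\<close> below.
\<close>

definition invariant_measure ::
    "real^'d^'d \<Rightarrow> (real^'d) set \<Rightarrow> (real^'d) measure \<Rightarrow> bool" where
  "invariant_measure R B M \<longleftrightarrow>
     prob_space M \<and> sets M = sets borel \<and>
     (\<forall>A\<in>sets borel. measure M A =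
        1 / real (card B) * (\<Sum>b\<in>B. measure M (ifs_map R b -` A)))"

definition Gamma_set :: "real^'d^'d \<Rightarrow> (real^'d) set \<Rightarrow> (real^'d) set" where
  "Gamma_set R B =
     {(\<Sum>k\<le>n. ((*v) R ^^ k) (b k)) | n b. \<forall>k\<le>n. b k \<in> B}"

definition L2_inner ::
    "(real^'d) measure \<Rightarrow> (real^'d \<Rightarrow> complex) \<Rightarrow> (real^'d \<Rightarrow> complex) \<Rightarrow> complex" where
  "L2_inner M f g = (LINT x|M. f x * cnj (g x))"

definition orthogonal_in_L2 :: "(real^'d) measure \<Rightarrow> (real^'d) set \<Rightarrow> bool" where
  "orthogonal_in_L2 M \<Gamma> \<longleftrightarrow>
     (\<forall>\<gamma>1\<in>\<Gamma>. \<forall>\<gamma>2\<in>\<Gamma>. \<gamma>1 \<noteq> \<gamma>2 \<longrightarrow> L2_inner M (expo \<gamma>1) (expo \<gamma>2) = 0)"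

end

theory Submission imports Defs begin

text \<open>
  Write \<open>F t = \<integral> e\<^sub>t d\<mu>\<close> for the Fourier transform of an invariant measure \<open>\<mu>\<close> of \<open>(R, B)\<close>, so
  that \<open>\<langle>e\<^sub>\<gamma>, e\<^bsub>\<gamma>'\<^esub>\<rangle> = F (\<gamma> - \<gamma>')\<close>. For \<open>t = R\<^sup>T s\<close> one has
  \<open>e\<^sub>t (R\<^sup>-\<^sup>1 (x + b)) = e\<^sub>t (R\<^sup>-\<^sup>1 b) e\<^sub>s (x)\<close>, so invariance gives (\<open>integral_expo_refinement\<close>)

    \<open>F t = 1/N (\<Sum>b\<in>B. e\<^sub>t (R\<^sup>-\<^sup>1 b)) F s\<close>.

  Two distinct points of \<open>\<Gamma>(L)\<close> have digit expansions in the base \<open>R\<^sup>T\<close>, which leading zeros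
  bring to the same length. While the lowest digits agree, the difference of the two points is
  \<open>R\<^sup>T\<close> times a shorter difference, and it is enough that \<open>F\<close> vanishes there. At the first
  place where the digits \<open>l\<close> and \<open>l'\<close> differ, the difference is
  \<open>t = (l - l') + R\<^sup>T s\<close>, where \<open>s \<bullet> b\<close> is an integer for all \<open>b \<in> B\<close>. Then
  \<open>e\<^sub>t (R\<^sup>-\<^sup>1 b) = e\<^bsub>l - l'\<^esub> (R\<^sup>-\<^sup>1 b)\<close>, and the average over \<open>b\<close> is the inner product of two distinct
  columns of the Hadamard matrix, hence zero. This is \<open>integral_expo_digit_difference\<close>.

  The other half of the theorem is the same statement for \<open>(R\<^sup>T, L, B)\<close>, with the rows of the
  matrix in place of its columns. To serve both halves, the lemmas assume of the matrix itself only
  that it is invertible: this follows from expansiveness and passes to the transpose at once.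
\<close>

section \<open>Exponentials\<close>

lemma expo_measurable [measurable]: "expo t \<in> borel_measurable borel"
  unfolding expo_def by measurable

lemma norm_expo [simp]: "norm (expo t x) = 1"
  by (simp add: expo_def norm_exp_eq_Re)

lemma expo_mult_cnj: "expo s x * cnj (expo t x) = expo (s - t) x"
  by (simp add: expo_def exp_cnj flip: exp_add)
     (simp add: algebra_simps inner_diff_left)

lemma expo_add_right: "expo t (x + y) = expo t x * expo t y"
  by (simp add: expo_def inner_add_right algebra_simps flip: exp_add)

lemma expo_add_left: "expo (s + t) x = expo s x * expo t x"
  by (simp add: expo_def inner_add_left algebra_simps flip: exp_add)

lemma expo_eq_1:
  assumes "t \<bullet> x \<in> \<int>"
  shows "expo t x = 1"
  using exp_integer_2pi[OF assms] by (simp add: expo_def mult_ac)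

section \<open>Matrices\<close>

text \<open>
  The transpose appears below as a base of digit expansions in its own right, so the normal form
  \<open>x v* R\<close> of \<open>transpose R *v x\<close> is switched off.
\<close>

declare transpose_matrix_vector [simp del]

lemma matrix_inv_cancel:
  fixes R :: "real^'d^'d"
  assumes "invertible R"
  shows "R *v (matrix_inv R *v x) = x"
proof -
  have "R ** matrix_inv R = mat 1 \<and> matrix_inv R ** R = mat 1"
    using assms unfolding invertible_def matrix_inv_def by (rule someI_ex)
  then show ?thesis
    by (simp add: matrix_vector_mul_assoc)
qed

lemma inner_transpose_matrix:
  fixes R :: "real^'d^'d"
  shows "(transpose R *v x) \<bullet> y = x \<bullet> (R *v y)"
  by (metis dot_lmul_matrix vector_transpose_matrix transpose_transpose)

lemma inner_transpose_funpow:
  fixes R :: "real^'d^'d"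
  shows "(((*v) (transpose R) ^^ k) x) \<bullet> y = x \<bullet> (((*v) R ^^ k) y)"
  by (induction k arbitrary: x y)
     (simp_all add: inner_transpose_matrix funpow_swap1)

lemma inner_matrix_inv_transpose:
  fixes R :: "real^'d^'d"
  assumes "invertible R"
  shows "(matrix_inv (transpose R) *v l) \<bullet> b = (matrix_inv R *v b) \<bullet> l"
proof -
  let ?u = "matrix_inv (transpose R) *v l" and ?v = "matrix_inv R *v b"
  have "?u \<bullet> b = ?u \<bullet> (R *v ?v)"
    by (simp add: matrix_inv_cancel assms)
  also have "\<dots> = (transpose R *v ?u) \<bullet> ?v"
    by (simp add: inner_transpose_matrix)
  also have "\<dots> = ?v \<bullet> l"
    by (simp add: matrix_inv_cancel transpose_invertible assms inner_commute)
  finally show ?thesis .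
qed

text \<open>
  A real kernel vector, read as a complex one, is an eigenvector for the eigenvalue \<open>0\<close>.
\<close>

lemma expansive_imp_invertible:
  fixes R :: "real^'d^'d"
  assumes "expansive R"
  shows "invertible R"
proof -
  let ?C = "(\<chi> i j. complex_of_real (R $ i $ j)) :: complex^'d^'d"
  have "x = 0" if "R *v x = 0" for x
  proof (rule ccontr)
    assume "x \<noteq> 0"
    let ?v = "(\<chi> i. complex_of_real (x $ i)) :: complex^'d"
    have "?C *v ?v = 0 *s ?v"
    proof (rule vec_eq_iff[THEN iffD2], rule allI)
      fix i
      have "(?C *v ?v) $ i = complex_of_real ((R *v x) $ i)"
        by (simp add: matrix_vector_mult_def)
      then show "(?C *v ?v) $ i = (0 *s ?v) $ i"
        using that by simp
    qed
    moreover have "?v \<noteq> 0"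
      using \<open>x \<noteq> 0\<close> by (auto simp: vec_eq_iff)
    ultimately have "eigenvalue_of ?C 0"
      unfolding eigenvalue_of_def by blast
    with assms show False
      unfolding expansive_def by fastforce
  qed
  then have "\<exists>A. A ** R = mat 1"
    by (simp add: matrix_left_invertible_ker)
  then show ?thesis
    by (meson invertible_def matrix_left_right_inverse)
qed

section \<open>Integration against an invariant measure\<close>

lemma ifs_map_measurable [measurable]: "ifs_map R b \<in> borel_measurable borel"
  unfolding ifs_map_def
  by (intro borel_measurable_continuous_onI continuous_intros
        linear_continuous_on_compose[OF _ matrix_vector_mul_linear])

text \<open>
  Invariance is a statement about measures of sets. It says that \<open>M\<close> is the image, under
  \<open>(b, x) \<mapsto> \<tau>\<^sub>b x\<close>, of the product of the uniform distribution on \<open>B\<close> with \<open>M\<close>; Fubini then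
  gives the formula for integrals.
\<close>

lemma integral_invariant_measure:
  fixes f :: "real^'d \<Rightarrow> complex"
  assumes inv: "invariant_measure R B M" and B: "finite B" "B \<noteq> {}"
    and f [measurable]: "f \<in> borel_measurable borel" and bound: "\<And>x. norm (f x) \<le> C"
  shows "(LINT x|M. f x) = (\<Sum>b\<in>B. LINT x|M. f (ifs_map R b x)) / of_nat (card B)"
proof -
  interpret M: prob_space M
    using inv by (simp add: invariant_measure_def)
  have sM [measurable_cong]: "sets M = sets borel"
    using inv by (simp add: invariant_measure_def)
  have spM: "space M = UNIV"
    using sets_eq_imp_space_eq[OF sM] by simp
  define U where "U = uniform_count_measure B"
  have sU [measurable_cong]: "sets U = sets (count_space B)"
    by (simp add: U_def sets_uniform_count_measure)
  have spU: "space U = B"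
    by (simp add: U_def space_uniform_count_measure)
  interpret U: prob_space U
    unfolding U_def using B by (rule prob_space_uniform_count_measure)
  interpret P: pair_prob_space U M ..
  define T where "T = (\<lambda>(b, x). ifs_map R b x)"
  have "T \<in> count_space B \<Otimes>\<^sub>M M \<rightarrow>\<^sub>M borel"
    using B by (intro measurable_pair_measure_countable1)
      (auto simp: T_def countable_finite)
  then have T [measurable]: "T \<in> U \<Otimes>\<^sub>M M \<rightarrow>\<^sub>M borel"
    by (simp add: measurable_cong_sets[OF sets_pair_measure_cong[OF sU refl] refl])
  have M_eq: "M = distr (U \<Otimes>\<^sub>M M) borel T"
  proof (rule measure_eqI)
    show "sets M = sets (distr (U \<Otimes>\<^sub>M M) borel T)"
      by (simp add: sM)
    fix A assume "A \<in> sets M"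
    then have A [measurable]: "A \<in> sets borel"
      by (simp add: sM)
    have Tm: "T -` A \<inter> space (U \<Otimes>\<^sub>M M) \<in> sets (U \<Otimes>\<^sub>M M)"
      using T A by (rule measurable_sets)
    have "emeasure (distr (U \<Otimes>\<^sub>M M) borel T) A
        = (\<integral>\<^sup>+ b. emeasure M (Pair b -` (T -` A \<inter> space (U \<Otimes>\<^sub>M M))) \<partial>U)"
      using T A by (simp add: emeasure_distr M.emeasure_pair_measure_alt[OF Tm])
    also have "\<dots> = (\<integral>\<^sup>+ b. ennreal (measure M (ifs_map R b -` A)) \<partial>U)"
      by (intro nn_integral_cong)
         (auto simp: T_def space_pair_measure spU spM M.emeasure_eq_measure
           intro!: arg_cong[where f = "measure M"])
    also have "\<dots> = (\<Sum>b\<in>B. ennreal (1 / real (card B)) * ennreal (measure M (ifs_map R b -` A)))"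
      unfolding U_def uniform_count_measure_def using B
      by (simp add: nn_integral_point_measure_finite)
    also have "\<dots> = ennreal (1 / real (card B) * (\<Sum>b\<in>B. measure M (ifs_map R b -` A)))"
      by (simp add: sum_distrib_left ennreal_mult' del: times_divide_eq_left flip: sum_ennreal)
    also have "\<dots> = emeasure M A"
      using inv A by (simp add: invariant_measure_def M.emeasure_eq_measure)
    finally show "emeasure M A = emeasure (distr (U \<Otimes>\<^sub>M M) borel T) A" ..
  qed
  have int: "integrable (U \<Otimes>\<^sub>M M) (\<lambda>p. f (T p))"
    using bound by (intro P.integrable_const_bound[where B = C]) auto
  have "(LINT x|M. f x) = (LINT p|(U \<Otimes>\<^sub>M M). f (T p))"
    by (subst M_eq, rule integral_distr) measurable
  also have "\<dots> = (LINT b|U. LINT x|M. f (T (b, x)))"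
    using P.integral_fst'[OF int] by simp
  also have "\<dots> = (\<Sum>b\<in>B. LINT x|M. f (ifs_map R b x)) / of_nat (card B)"
    unfolding U_def uniform_count_measure_def using B
    by (simp add: lebesgue_integral_point_measure_finite T_def scaleR_conv_of_real
        sum_divide_distrib)
  finally show ?thesis .
qed

text \<open>
  The functional equation of the Fourier transform. The factor is the mask of \<open>B\<close>, and it is at
  its zeros that orthogonality originates.
\<close>

lemma integral_expo_refinement:
  assumes "invariant_measure R B M" "finite B" "B \<noteq> {}" "invertible R"
  shows "(LINT x|M. expo (transpose R *v s) x) =
    (\<Sum>b\<in>B. expo (transpose R *v s) (matrix_inv R *v b)) / of_nat (card B) * (LINT x|M. expo s x)"
proof -
  let ?t = "transpose R *v s"
  have *: "expo ?t (ifs_map R b x) = expo ?t (matrix_inv R *v b) * expo s x" for b x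
  proof -
    have "?t \<bullet> (matrix_inv R *v x) = s \<bullet> x"
      by (simp add: inner_transpose_matrix matrix_inv_cancel assms)
    then show ?thesis
      by (simp add: ifs_map_def matrix_vector_right_distrib expo_add_right)
         (simp add: expo_def)
  qed
  show ?thesis
    by (subst integral_invariant_measure[OF assms(1-3), where C = 1])
       (simp_all add: * sum_distrib_right)
qed

section \<open>Digit expansions\<close>

lemma linear_funpow_matrix:
  fixes R :: "real^'d^'d"
  shows "linear ((*v) R ^^ k)"
  by (induction k) (simp_all add: linear_id linear_compose[unfolded o_def] o_def
      flip: id_def)

lemma digit_sum_Suc:
  fixes R :: "real^'d^'d"
  shows "(\<Sum>k<Suc n. ((*v) R ^^ k) (b k)) = b 0 + R *v (\<Sum>k<n. ((*v) R ^^ k) (b (Suc k)))"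
  by (simp add: sum.lessThan_Suc_shift linear_sum[OF matrix_vector_mul_linear] del: sum.lessThan_Suc)

text \<open>
  Padding by the digit \<open>0\<close> gives a point of \<open>\<Gamma>\<close> an expansion of every sufficiently large length, so
  two points can be compared digit by digit. The digit sequence takes values in \<open>L\<close> at all
  indices, also beyond the length, which spares range conditions later.
\<close>

lemma Gamma_set_digits:
  assumes "\<gamma> \<in> Gamma_set R L" "0 \<in> L"
  obtains n where "\<And>m. m \<ge> n \<Longrightarrow> \<exists>l. (\<forall>k. l k \<in> L) \<and> \<gamma> = (\<Sum>k<m. ((*v) R ^^ k) (l k))"
proof -
  obtain n l where l: "\<forall>k\<le>n. l k \<in> L" and \<gamma>: "\<gamma> = (\<Sum>k\<le>n. ((*v) R ^^ k) (l k))"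
    using assms(1) by (auto simp: Gamma_set_def)
  show thesis
  proof (rule that[of "Suc n"], intro exI conjI allI)
    fix m assume m: "m \<ge> Suc n"
    let ?l = "\<lambda>k. if k \<le> n then l k else 0"
    show "?l k \<in> L" for k
      using l assms(2) by simp
    have "\<gamma> = (\<Sum>k\<le>n. ((*v) R ^^ k) (?l k))"
      by (simp add: \<gamma>)
    also have "\<dots> = (\<Sum>k<m. ((*v) R ^^ k) (?l k))"
      using m by (intro sum.mono_neutral_left)
        (auto simp: linear_0[OF linear_funpow_matrix])
    finally show "\<gamma> = (\<Sum>k<m. ((*v) R ^^ k) (?l k))" .
  qed
qed

section \<open>Orthogonality\<close>

text \<open>
  The induction is on the common length of the expansions and strips off the lowest digits. The
  hypothesis \<open>cols\<close> is orthogonality of the columns of the Hadamard matrix; \<open>ints\<close> makes the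
  higher digits invisible to the sum over \<open>B\<close>.
\<close>

lemma integral_expo_digit_difference:
  fixes R :: "real^'d^'d"
  assumes inv: "invariant_measure R B M" and B: "finite B" "B \<noteq> {}" and R: "invertible R"
    and ints: "\<And>b l k. b \<in> B \<Longrightarrow> l \<in> L \<Longrightarrow> l \<bullet> (((*v) R ^^ k) b) \<in> \<int>"
    and cols: "\<And>l l'. l \<in> L \<Longrightarrow> l' \<in> L \<Longrightarrow> l \<noteq> l' \<Longrightarrow>
      (\<Sum>b\<in>B. expo (l - l') (matrix_inv R *v b)) = 0"
    and "\<And>k. l k \<in> L" "\<And>k. l' k \<in> L"
    and "(\<Sum>k<n. ((*v) (transpose R) ^^ k) (l k)) \<noteq> (\<Sum>k<n. ((*v) (transpose R) ^^ k) (l' k))"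
  shows "(LINT x|M. expo ((\<Sum>k<n. ((*v) (transpose R) ^^ k) (l k)) -
    (\<Sum>k<n. ((*v) (transpose R) ^^ k) (l' k))) x) = 0"
  using assms(7-)
proof (induction n arbitrary: l l')
  case 0
  then show ?case by simp
next
  case (Suc n)
  let ?g = "\<lambda>l. \<Sum>k<n. ((*v) (transpose R) ^^ k) (l (Suc k))"
  let ?s = "?g l - ?g l'"
  define t where "t = (l 0 - l' 0) + transpose R *v ?s"
  have t: "(\<Sum>k<Suc n. ((*v) (transpose R) ^^ k) (l k)) -
      (\<Sum>k<Suc n. ((*v) (transpose R) ^^ k) (l' k)) = t"
    unfolding digit_sum_Suc t_def by (simp add: matrix_vector_mult_diff_distrib)
  show ?case
  proof (cases "l 0 = l' 0")
    case True
    then have t': "t = transpose R *v ?s"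
      by (simp add: t_def)
    have "?g l \<noteq> ?g l'"
    proof
      assume "?g l = ?g l'"
      then have "t = 0" by (simp add: t')
      then show False using t Suc.prems(3) by simp
    qed
    then have "(LINT x|M. expo ?s x) = 0"
      using Suc.prems by (intro Suc.IH) auto
    then show ?thesis
      unfolding t t' by (simp add: integral_expo_refinement[OF inv B R])
  next
    case False
    \<comment> \<open>The higher digits contribute \<open>?s \<bullet> b\<close>, an integer, to the exponent.\<close>
    have "expo t (matrix_inv R *v b) = expo (l 0 - l' 0) (matrix_inv R *v b)" if "b \<in> B" for b
    proof -
      have "(transpose R *v ?s) \<bullet> (matrix_inv R *v b) = ?s \<bullet> b"
        by (simp add: inner_transpose_matrix matrix_inv_cancel R)
      also have "\<dots> \<in> \<int>"
        using Suc.prems that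
        by (auto simp: inner_diff_left inner_sum_left inner_transpose_funpow
            intro!: Ints_diff Ints_sum ints)
      finally show ?thesis
        by (simp add: t_def expo_add_left expo_eq_1)
    qed
    then have "(\<Sum>b\<in>B. expo t (matrix_inv R *v b)) = 0"
      using cols[OF Suc.prems(1,2) False] by simp
    \<comment> \<open>The refinement equation applies at \<open>t\<close>, which lies in the range of \<open>transpose R\<close>.\<close>
    moreover have "transpose R *v (matrix_inv (transpose R) *v t) = t"
      using R by (simp add: matrix_inv_cancel transpose_invertible)
    ultimately show ?thesis
      unfolding t
      using integral_expo_refinement[OF inv B R, of "matrix_inv (transpose R) *v t"] by simp
  qed
qed

lemma orthogonal_Gamma_set_transpose:
  fixes R :: "real^'d^'d"
  assumes inv: "invariant_measure R B M" and B: "finite B" "B \<noteq> {}" and R: "invertible R"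
    and L: "0 \<in> L"
    and ints: "\<And>b l k. b \<in> B \<Longrightarrow> l \<in> L \<Longrightarrow> l \<bullet> (((*v) R ^^ k) b) \<in> \<int>"
    and cols: "\<And>l l'. l \<in> L \<Longrightarrow> l' \<in> L \<Longrightarrow> l \<noteq> l' \<Longrightarrow>
      (\<Sum>b\<in>B. expo (l - l') (matrix_inv R *v b)) = 0"
  shows "orthogonal_in_L2 M (Gamma_set (transpose R) L)"
  unfolding orthogonal_in_L2_def
proof (intro ballI impI)
  fix \<gamma>1 \<gamma>2
  assume \<gamma>: "\<gamma>1 \<in> Gamma_set (transpose R) L" "\<gamma>2 \<in> Gamma_set (transpose R) L" "\<gamma>1 \<noteq> \<gamma>2"
  let ?S = "\<lambda>n l. \<Sum>k<n. ((*v) (transpose R) ^^ k) (l k)"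
  obtain n1 where n1: "\<And>m. m \<ge> n1 \<Longrightarrow> \<exists>l. (\<forall>k. l k \<in> L) \<and> \<gamma>1 = ?S m l"
    using Gamma_set_digits[OF \<gamma>(1) L] by blast
  obtain n2 where n2: "\<And>m. m \<ge> n2 \<Longrightarrow> \<exists>l. (\<forall>k. l k \<in> L) \<and> \<gamma>2 = ?S m l"
    using Gamma_set_digits[OF \<gamma>(2) L] by blast
  obtain l where l: "\<And>k. l k \<in> L" "\<gamma>1 = ?S (max n1 n2) l"
    using n1[of "max n1 n2"] by auto
  obtain l' where l': "\<And>k. l' k \<in> L" "\<gamma>2 = ?S (max n1 n2) l'"
    using n2[of "max n1 n2"] by auto
  have "(LINT x|M. expo (\<gamma>1 - \<gamma>2) x) = 0"
    unfolding l(2) l'(2)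
    by (rule integral_expo_digit_difference[OF inv B R ints cols l(1) l'(1)])
       (use \<gamma>(3) l(2) l'(2) in auto)
  then show "L2_inner M (expo \<gamma>1) (expo \<gamma>2) = 0"
    by (simp add: L2_inner_def expo_mult_cnj)
qed

lemma hadamard_system_columns:
  assumes H: "hadamard_system R B L" and l: "l \<in> L" "l' \<in> L" "l \<noteq> l'"
  shows "(\<Sum>b\<in>B. expo (l - l') (matrix_inv R *v b)) = 0"
proof -
  let ?c = "complex_of_real (1 / sqrt (real (card B)))"
  let ?U = "\<lambda>b l. ?c * expo l (matrix_inv R *v b)"
  have "card B \<noteq> 0"
    using H by (auto simp: hadamard_system_def)
  then have c: "?c \<noteq> 0" by simp
  have "unitary_on B L (\<lambda>b l. ?c * exp (2 * complex_of_real pi * \<i> *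
      complex_of_real ((matrix_inv R *v b) \<bullet> l)))"
    using H unfolding hadamard_system_def by blast
  then have "unitary_on B L ?U"
    by (simp only: expo_def inner_commute)
  then have "(\<Sum>b\<in>B. cnj (?U b l') * ?U b l) = 0"
    using l unfolding unitary_on_def by auto
  moreover have "cnj (?U b l') * ?U b l = ?c * ?c * expo (l - l') (matrix_inv R *v b)" for b
    by (simp add: mult_ac flip: expo_mult_cnj)
  ultimately have "?c * ?c * (\<Sum>b\<in>B. expo (l - l') (matrix_inv R *v b)) = 0"
    by (simp only: sum_distrib_left)
  with c show ?thesis by simp
qed

text \<open>
  The rows of the matrix of \<open>(R, B, L)\<close> are the columns of that of \<open>(R\<^sup>T, L, B)\<close>, because
  \<open>(R\<^sup>T)\<^sup>-\<^sup>1 l \<bullet> b = R\<^sup>-\<^sup>1 b \<bullet> l\<close>.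
\<close>

lemma hadamard_system_rows:
  fixes R :: "real^'d^'d"
  assumes H: "hadamard_system R B L" and b: "b \<in> B" "b' \<in> B" "b \<noteq> b'"
  shows "(\<Sum>l\<in>L. expo (b - b') (matrix_inv (transpose R) *v l)) = 0"
proof -
  let ?c = "complex_of_real (1 / sqrt (real (card B)))"
  let ?U = "\<lambda>b l. ?c * expo b (matrix_inv (transpose R) *v l)"
  have "card B \<noteq> 0"
    using H by (auto simp: hadamard_system_def)
  then have c: "?c \<noteq> 0" by simp
  have R: "invertible R"
    using H by (simp add: hadamard_system_def expansive_imp_invertible)
  have "b \<bullet> (matrix_inv (transpose R) *v l) = (matrix_inv R *v b) \<bullet> l" for b l
    using inner_matrix_inv_transpose[OF R, of l b] by (simp only: inner_commute)
  moreover have "unitary_on B L (\<lambda>b l. ?c * exp (2 * complex_of_real pi * \<i> *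
      complex_of_real ((matrix_inv R *v b) \<bullet> l)))"
    using H unfolding hadamard_system_def by blast
  ultimately have "unitary_on B L ?U"
    by (simp only: expo_def)
  then have "(\<Sum>l\<in>L. ?U b l * cnj (?U b' l)) = 0"
    using b unfolding unitary_on_def by auto
  moreover have "?U b l * cnj (?U b' l) = ?c * ?c * expo (b - b') (matrix_inv (transpose R) *v l)" for l
    by (simp add: mult_ac flip: expo_mult_cnj)
  ultimately have "?c * ?c * (\<Sum>l\<in>L. expo (b - b') (matrix_inv (transpose R) *v l)) = 0"
    by (simp only: sum_distrib_left)
  with c show ?thesis by simp
qed

theorem proposition2p6:
  fixes R :: "real^'d^'d" and B L :: "(real^'d) set"
    and \<mu>B \<mu>L :: "(real^'d) measure"
  assumes "hadamard_system R B L"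
    and "invariant_measure R B \<mu>B"
    and "invariant_measure (transpose R) L \<mu>L"
  shows "orthogonal_in_L2 \<mu>L (Gamma_set R B) \<and>
         orthogonal_in_L2 \<mu>B (Gamma_set (transpose R) L)"
proof
  note H = assms(1)
  have R: "invertible R" and B: "finite B" "B \<noteq> {}" "0 \<in> B" and L: "finite L" "L \<noteq> {}" "0 \<in> L"
    using H by (auto simp: hadamard_system_def expansive_imp_invertible)
  have ints: "l \<bullet> (((*v) R ^^ k) b) \<in> \<int>" if "b \<in> B" "l \<in> L" for b l k
    using H that by (simp add: hadamard_system_def inner_commute)
  show "orthogonal_in_L2 \<mu>B (Gamma_set (transpose R) L)"
    using assms(2) B(1,2) R L(3)
    by (rule orthogonal_Gamma_set_transpose)
       (simp_all add: ints hadamard_system_columns[OF H])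
  have "orthogonal_in_L2 \<mu>L (Gamma_set (transpose (transpose R)) B)"
    using assms(3) L(1,2) transpose_invertible[OF R] B(3)
  proof (rule orthogonal_Gamma_set_transpose)
    fix l b k assume "l \<in> L" "b \<in> B"
    then show "b \<bullet> (((*v) (transpose R) ^^ k) l) \<in> \<int>"
      using ints[of b l k] inner_transpose_funpow[of k R l b] by (simp add: inner_commute)
  qed (rule hadamard_system_rows[OF H])
  then show "orthogonal_in_L2 \<mu>L (Gamma_set R B)"
    by simp
qed

end
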